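(* Let $\lambda>-\frac12$, let $n\ge 0$ be an integer, and let $(\alpha_{ij})_{0\le i,j\le n}$ be the matrix with entries $$\alpha_{ij}=\frac{1+(-1)^{i+j}}{2}\,B\!\left(\frac{i+j+1}{2},\lambda+\frac12\right),\qquad i,j=0,1,\dots,n.$$ Then $$\det(\alpha_{ij})_{i,j=0}^{n}=\prod_{k=0}^{n}\frac{\pi\, k!\,\Gamma(2\lambda+k)}{(\lambda+k)\,2^{2\lambda+2k-1}\,\Gamma(\lambda+k)^{2}},$$ or $$\det(\alpha_{ij})_{i,j=0}^{n}=\frac{\pi^{n+1}G(n+2)}{2^{(n+1)(n+2\lambda-1)}(\lambda)_{n+1}}\cdot\frac{G(2\lambda+n+1)\,G(\lambda)^{2}}{G(2\lambda)\,G(\lambda+n+1)^{2}}.$$ The inverse matrix $(\beta_{ij})_{0\le i,j\le n}$ has entries $$\beta_{ij}=\frac{2^{i+j}(\lambda)_{i}(\lambda)_{j}\Gamma(\lambda)}{i!\,j!\,\sqrt{\pi}\,\Gamma(\lambda+\frac12)}\sum_{k=\max(i,j)}^{n}\frac{k!\,(\lambda+k)\,C_{k-i}^{\lambda+i}(0)\,C_{k-j}^{\lambda+j}(0)}{(2\lambda)_{k}}$$ for $i,j=0,1,\dots,n$.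
   Context: $\Gamma$ is Euler's gamma function, $(a)_n=\Gamma(a+n)/\Gamma(a)$ is the shifted factorial, and $B(p,q)=\int_0^1 x^{p-1}(1-x)^{q-1}\,dx$ is the beta integral. $C_n^{\lambda}$ ($n\ge0$) are the ultraspherical (Gegenbauer) polynomials $C_n^{\lambda}(x)=\frac{(2\lambda)_n}{n!}\,{}_2F_1\left(-n,2\lambda+n;\lambda+\tfrac12;\tfrac{1-x}{2}\right)$, where ${}_2F_1(a,b;c;z)=\sum_{m\ge0}\frac{(a)_m(b)_m}{(c)_m}\frac{z^m}{m!}$. $G$ is the Barnes $G$-function, the entire function given by $G(z+1)=(2\pi)^{z/2}e^{-[z(z+1)+\gamma z^2]/2}\prod_{m=1}^{\infty}\left(1+\frac zm\right)^m e^{-z+z^2/(2m)}$ with $\gamma$ Euler's constant; it satisfies $G(z+1)=\Gamma(z)G(z)$ and $G(1)=1$.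
   Formalization: At λ=0, where the right-hand sides are undefined (they involve Γ(0), G(0)=0 and (0)_k=0), the formulas are read as limits λ→0 giving the determinant and the entries of the inverse; for every other λ>-1/2 they hold as printed. *)

theory Defs
  imports
    "HOL-Analysis.Gamma_Function"
    "HOL-Analysis.Infinite_Products"
    "Jordan_Normal_Form.Determinant"
begin

text \<open>
  The shifted factorial \<open>(a)\<^sub>n = \<Gamma>(a+n)/\<Gamma>(a)\<close> is \<^const>\<open>pochhammer\<close>, its polynomial form, which is
  also meaningful at the poles of \<open>\<Gamma>\<close> (as needed for \<open>(-n)\<^sub>m\<close> below);
  see \<open>pochhammer_Gamma\<close>. The beta integral is \<^const>\<open>Beta\<close>; see \<open>has_integral_Beta_real\<close>.
\<close>

definition hyp2F1 :: "'a::{real_normed_field,banach} \<Rightarrow> 'a \<Rightarrow> 'a \<Rightarrow> 'a \<Rightarrow> 'a" where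
  "hyp2F1 a b c z =
     (\<Sum>m. pochhammer a m * pochhammer b m / pochhammer c m * z ^ m / fact m)"

definition ultraspherical :: "nat \<Rightarrow> real \<Rightarrow> real \<Rightarrow> real" where
  "ultraspherical n l x =
     pochhammer (2 * l) n / fact n * hyp2F1 (- real n) (2 * l + real n) (l + 1 / 2) ((1 - x) / 2)"

text \<open>
  The Barnes function is given by a formula for \<open>G(z+1)\<close>, hence the shift \<open>z = w - 1\<close>.
  The factor \<open>(2\<pi>)\<^bsup>z/2\<^esup>\<close> is written as \<open>exp (z/2 * ln (2\<pi>))\<close> so that the definition
  makes sense over both the real and the complex numbers; the product
  index \<open>k\<close> corresponds to \<open>m = k + 1\<close>.
\<close>

definition Barnes_G :: "'a::{real_normed_field,banach} \<Rightarrow> 'a" where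
  "Barnes_G w = (let z = w - 1 in
     exp (z / 2 * of_real (ln (2 * pi))) *
     exp (- (z * (z + 1) + of_real euler_mascheroni * z\<^sup>2) / 2) *
     (\<Prod>k. (1 + z / of_nat (Suc k)) ^ Suc k * exp (- z + z\<^sup>2 / (2 * of_nat (Suc k)))))"

definition alpha_entry :: "real \<Rightarrow> nat \<Rightarrow> nat \<Rightarrow> real" where
  "alpha_entry l i j = (1 + (- 1) ^ (i + j)) / 2 * Beta ((real i + real j + 1) / 2) (l + 1 / 2)"

definition alpha_mat :: "real \<Rightarrow> nat \<Rightarrow> real mat" where
  "alpha_mat l n = mat (n + 1) (n + 1) (\<lambda>(i, j). alpha_entry l i j)"

definition det_Gamma_form :: "real \<Rightarrow> nat \<Rightarrow> real" where
  "det_Gamma_form l n =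
     (\<Prod>k=0..n. pi * fact k * Gamma (2 * l + real k) /
        ((l + real k) * 2 powr (2 * l + 2 * real k - 1) * (Gamma (l + real k))\<^sup>2))"

definition det_Barnes_form :: "real \<Rightarrow> nat \<Rightarrow> real" where
  "det_Barnes_form l n =
     pi ^ (n + 1) * Barnes_G (real n + 2) /
       (2 powr ((real n + 1) * (real n + 2 * l - 1)) * pochhammer l (n + 1)) *
     (Barnes_G (2 * l + real n + 1) * (Barnes_G l)\<^sup>2 /
       (Barnes_G (2 * l) * (Barnes_G (l + real n + 1))\<^sup>2))"

definition beta_entry :: "real \<Rightarrow> nat \<Rightarrow> nat \<Rightarrow> nat \<Rightarrow> real" where
  "beta_entry l n i j =
     2 ^ (i + j) * pochhammer l i * pochhammer l j * Gamma l /
       (fact i * fact j * sqrt pi * Gamma (l + 1 / 2)) *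
     (\<Sum>k=max i j..n. fact k * (l + real k) *
        ultraspherical (k - i) (l + real i) 0 * ultraspherical (k - j) (l + real j) 0 /
        pochhammer (2 * l) k)"

definition beta_mat :: "real \<Rightarrow> nat \<Rightarrow> real mat" where
  "beta_mat l n = mat (n + 1) (n + 1) (\<lambda>(i, j). beta_entry l n i j)"

text \<open>
  As functions of \<open>l\<close> on \<open>l > -1/2\<close>, the three closed forms \<^const>\<open>det_Gamma_form\<close>,
  \<^const>\<open>det_Barnes_form\<close> and \<^const>\<open>beta_entry\<close> have exactly one exceptional point,
  \<open>l = 0\<close>: there they read \<open>\<infinity>/\<infinity>\<close> or \<open>0/0\<close> (poles of \<open>\<Gamma>(l)\<close> and \<open>\<Gamma>(2l)\<close>, zeros of
  \<open>G(l)\<close>, \<open>G(2l)\<close>, \<open>(l)\<^sub>n\<close> and \<open>(2l)\<^sub>k\<close>), a removable singularity. The value at \<open>l = 0\<close> is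
  therefore the limit as \<open>l \<rightarrow> 0\<close>; HOL's totalised \<open>Gamma 0 = 0\<close> and \<open>x / 0 = 0\<close>
  would give something else.
\<close>

end

theory Submission
  imports Defs "HOL-Real_Asymp.Real_Asymp"
begin

text \<open>
  The matrix \<open>\<alpha>\<close> is the moment matrix of the weight \<open>(1 - x\<^sup>2)\<close> to the power \<open>l - 1/2\<close>. If \<open>C\<close> is the lower
  triangular matrix of the coefficients of the ultraspherical polynomials, orthogonality says that
  \<open>C \<alpha>\<close> is upper triangular and \<open>C \<alpha> C\<^sup>T\<close> is diagonal with the squared norms on the diagonal; this gives the
  determinant and \<open>\<beta> = C\<^sup>T (C \<alpha> C\<^sup>T)\<^sup>-\<^sup>1 C\<close>. Instead of integrating, one obtains all inner products of \<open>x\<^sup>j\<close>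
  and \<open>C\<^sub>k\<close> in closed form from the three-term recurrence. The Barnes form of the determinant follows from
  \<open>G(w+1) = \<Gamma>(w) G(w)\<close>, which is proved by telescoping the partial products and Stirling's formula. At \<open>l = 0\<close>,
  where \<open>C\<close> is singular, everything follows by continuity of \<open>\<alpha>\<close> in \<open>l\<close>, because each pivot of \<open>\<alpha>\<close> has
  a nonzero limit.
\<close>

subsection \<open>The functional equation of the Barnes function\<close>

text \<open>The exponents substituted below tend to 0 but may equal 0, as for z = 0, so the bound is
  wanted on the full neighbourhood and not only on the punctured one.\<close>

lemma exp_minus_one_bigo: "(\<lambda>e::real. exp e - 1) \<in> O[nhds 0](\<lambda>e. e)"
proof -
  have "(\<lambda>e::real. exp e - 1) \<in> O[at 0](\<lambda>e. e)"
    by real_asymp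
  then obtain c where "eventually (\<lambda>e::real. norm (exp e - 1) \<le> c * norm e) (at 0)"
    by (auto elim: landau_o.bigE)
  then have "eventually (\<lambda>e::real. norm (exp e - 1) \<le> c * norm e) (nhds 0)"
    by (simp add: eventually_nhds_conv_at)
  then show ?thesis by (rule bigoI)
qed

text \<open>The exponent is \<open>x * h (z / x)\<close>, where \<open>h t\<close> is the logarithm
  \<open>ln (1 + t)\<close> minus its second-order Taylor polynomial. From h = O(t^3) the exponent
  is O(1/x^2), and \<open>exp e - 1\<close> has the order of e.\<close>

lemma barnes_factor_bigo:
  fixes z :: real
  shows "(\<lambda>x. exp (x * ln (1 + z / x) - z + z\<^sup>2 / (2 * x)) - 1) \<in> O(\<lambda>x. 1 / x\<^sup>2)"
proof -
  define h :: "real \<Rightarrow> real" where "h = (\<lambda>t. ln (1 + t) - t + t\<^sup>2 / 2)"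
  have "h \<in> O[at 0](\<lambda>t. t ^ 3)"
    unfolding h_def by real_asymp
  then obtain c where "eventually (\<lambda>t::real. norm (h t) \<le> c * norm (t ^ 3)) (at 0)"
    by (auto elim: landau_o.bigE)
  then have "eventually (\<lambda>t::real. norm (h t) \<le> c * norm (t ^ 3)) (nhds 0)"
    by (simp add: eventually_nhds_conv_at h_def)
  then have "h \<in> O[nhds 0](\<lambda>t. t ^ 3)" by (rule bigoI)
  moreover have "((\<lambda>x. z / x) \<longlongrightarrow> 0) at_top" by real_asymp
  ultimately have "(\<lambda>x. h (z / x)) \<in> O(\<lambda>x. (z / x) ^ 3)"
    by (rule landau_o.big.compose)
  then have "(\<lambda>x. x * h (z / x)) \<in> O(\<lambda>x. x * (z / x) ^ 3)"
    by (intro landau_o.big.mult_left)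
  also have "(\<lambda>x. x * (z / x) ^ 3) \<in> O(\<lambda>x. 1 / x\<^sup>2)"
    by (rule bigoI[of _ "\<bar>z\<bar> ^ 3"], rule eventually_mono[OF eventually_gt_at_top[of 0]])
       (simp add: abs_mult power_abs power_divide field_simps eval_nat_numeral)
  finally have e: "(\<lambda>x. x * h (z / x)) \<in> O(\<lambda>x. 1 / x\<^sup>2)" .
  have "(\<lambda>x::real. 1 / x\<^sup>2) \<in> o(\<lambda>_. 1)" by real_asymp
  with e have "(\<lambda>x. x * h (z / x)) \<in> o(\<lambda>_. 1)"
    by (rule landau_o.big_small_trans)
  then have "((\<lambda>x. x * h (z / x)) \<longlongrightarrow> 0) at_top"
    using smalloD_tendsto by fastforce
  with exp_minus_one_bigo have "(\<lambda>x. exp (x * h (z / x)) - 1) \<in> O(\<lambda>x. x * h (z / x))"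
    by (rule landau_o.big.compose)
  with e have *: "(\<lambda>x. exp (x * h (z / x)) - 1) \<in> O(\<lambda>x. 1 / x\<^sup>2)"
    by (rule landau_o.big_trans[rotated])
  have "eventually (\<lambda>x::real. exp (x * h (z / x)) - 1 = exp (x * ln (1 + z / x) - z + z\<^sup>2 / (2 * x)) - 1) at_top"
    using eventually_gt_at_top[of 0]
    by eventually_elim (simp add: h_def algebra_simps power2_eq_square)
  with * show ?thesis by (simp cong: landau_o.big.in_cong)
qed

definition barnes_factor :: "real \<Rightarrow> nat \<Rightarrow> real" where
  "barnes_factor z k = (1 + z / of_nat (Suc k)) ^ Suc k * exp (- z + z\<^sup>2 / (2 * of_nat (Suc k)))"

lemma convergent_prod_barnes_factor: "convergent_prod (barnes_factor z)"
proof -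
  let ?g = "\<lambda>x::real. exp (x * ln (1 + z / x) - z + z\<^sup>2 / (2 * x)) - 1"
  have 1: "(\<lambda>k. ?g (real (Suc k))) \<in> O(\<lambda>k. 1 / (real (Suc k))\<^sup>2)"
    using landau_o.big.compose[OF barnes_factor_bigo[of z], of "\<lambda>k. real (Suc k)" sequentially]
    by (simp add: filterlim_compose[OF filterlim_real_sequentially filterlim_Suc] del: of_nat_Suc)
  \<comment> \<open>Only where the base is positive is its power the exponential of a logarithm; for
    negative z this can fail for finitely many k.\<close>
  have "eventually (\<lambda>k. 1 + z / real (Suc k) > 0) sequentially"
    by real_asymp
  then have "eventually (\<lambda>k. ?g (real (Suc k)) = barnes_factor z k - 1) sequentially"
    by eventually_elim
       (simp only: barnes_factor_def exp_add exp_of_nat_mult exp_ln diff_conv_add_uminus mult.assoc)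
  then have "(\<lambda>k. ?g (real (Suc k))) \<in> O(\<lambda>k. 1 / (real (Suc k))\<^sup>2) \<longleftrightarrow>
     (\<lambda>k. barnes_factor z k - 1) \<in> O(\<lambda>k. 1 / (real (Suc k))\<^sup>2)"
    by (rule landau_o.big.in_cong)
  with 1 have "(\<lambda>k. norm (barnes_factor z k - 1)) \<in> O(\<lambda>k. 1 / (real (Suc k))\<^sup>2)" by simp
  moreover have "summable (\<lambda>k. 1 / (real (Suc k))\<^sup>2)"
    using inverse_power_summable[of 2, where ?'a = real]
          summable_Suc_iff[of "\<lambda>k. inverse ((real k)\<^sup>2)"]
    by (simp add: inverse_eq_divide)
  ultimately have "summable (\<lambda>k. norm (barnes_factor z k - 1))"
    using summable_comparison_test_bigo[of "\<lambda>k. 1 / (real (Suc k))\<^sup>2"] by simp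
  then show ?thesis
    by (intro abs_convergent_prod_imp_convergent_prod) (simp add: abs_convergent_prod_conv_summable)
qed

lemma Barnes_G_real:
  "Barnes_G w = exp ((w - 1) / 2 * ln (2 * pi)) *
     exp (- ((w - 1) * w + euler_mascheroni * (w - 1)\<^sup>2) / 2) * prodinf (barnes_factor (w - 1))"
  for w :: real
  by (simp add: Barnes_G_def Let_def barnes_factor_def[abs_def])

lemma barnes_factor_nonzero:
  assumes "w \<notin> \<int>\<^sub>\<le>\<^sub>0"
  shows "barnes_factor (w - 1) k \<noteq> 0"
proof -
  have "w + real k \<noteq> 0"
    using assms by (auto dest!: plus_of_nat_eq_0_imp)
  moreover have "1 + (w - 1) / real (Suc k) = (w + real k) / real (Suc k)"
    by (simp add: field_simps)
  ultimately show ?thesis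
    by (simp add: barnes_factor_def)
qed

lemma Barnes_G_nonzero:
  assumes "w \<notin> \<int>\<^sub>\<le>\<^sub>0"
  shows "Barnes_G (w :: real) \<noteq> 0"
  using assms by (simp add: Barnes_G_real prodinf_nonzero convergent_prod_barnes_factor barnes_factor_nonzero)

lemma barnes_factor_0 [simp]: "barnes_factor 0 = (\<lambda>_. 1)"
  by (simp add: barnes_factor_def fun_eq_iff)

lemma Barnes_G_1 [simp]: "Barnes_G (1 :: real) = 1"
  by (simp add: Barnes_G_real)

section \<open>Comparison of the partial products at w and w - 1\<close>

text \<open>With k counted from 1, the bases of corresponding factors have quotient (w + k)/(w + k -
  1). Its k-th powers telescope to (w + N)^N divided by w (w + 1) ... (w + N - 1). The exponents
  differ by -1 + (w - 1/2)/k, which sums to a harmonic number.\<close>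

lemma prod_barnes_factor_shift:
  assumes "w \<notin> \<int>\<^sub>\<le>\<^sub>0"
  shows "(\<Prod>k<N. barnes_factor w k) =
    (\<Prod>k<N. barnes_factor (w - 1) k) *
      ((w + real N) ^ N / pochhammer w N * exp (- real N + (w - 1 / 2) * harm N))"
proof (induction N)
  case 0
  then show ?case by (simp add: harm_def)
next
  case (Suc N)
  have nz: "w + real N \<noteq> 0" for N
    using assms by (auto dest!: plus_of_nat_eq_0_imp)
  have p: "pochhammer w N \<noteq> 0"
    using assms pochhammer_eq_0_imp_nonpos_Int by blast
  have 1: "barnes_factor w N = barnes_factor (w - 1) N *
      ((w + real (Suc N)) / (w + real N)) ^ Suc N * exp (- 1 + (w - 1 / 2) * inverse (real (Suc N)))"
  proof -
    have "1 + w / real (Suc N) = (1 + (w - 1) / real (Suc N)) * ((w + real (Suc N)) / (w + real N))"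
      using nz[of N] by (simp add: divide_simps) (simp add: algebra_simps)
    moreover have "- w + w\<^sup>2 / (2 * real (Suc N)) = (- (w - 1) + (w - 1)\<^sup>2 / (2 * real (Suc N)))
        + (- 1 + (w - 1 / 2) * inverse (real (Suc N)))"
      by (simp add: divide_simps) (simp add: algebra_simps power2_eq_square)
    ultimately show ?thesis
      unfolding barnes_factor_def by (simp only: power_mult_distrib exp_add mult_ac)
  qed
  have "a ^ N / q * (b / a) ^ Suc N = b ^ Suc N / (q * a)" if "a \<noteq> 0" for a b q :: real
    using that by (simp add: power_divide)
  then have "(w + real N) ^ N / pochhammer w N * ((w + real (Suc N)) / (w + real N)) ^ Suc N
      = (w + real (Suc N)) ^ Suc N / pochhammer w (Suc N)"
    using nz[of N] by (simp only: pochhammer_Suc) auto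
  moreover have "exp (- real N + (w - 1 / 2) * harm N) * exp (- 1 + (w - 1 / 2) * inverse (real (Suc N)))
     = exp (- real (Suc N) + (w - 1 / 2) * harm (Suc N))"
    by (simp add: harm_Suc exp_add [symmetric] algebra_simps)
  ultimately have 2: "(w + real (Suc N)) ^ Suc N / pochhammer w (Suc N) * exp (- real (Suc N) + (w - 1 / 2) * harm (Suc N)) =
    ((w + real N) ^ N / pochhammer w N * ((w + real (Suc N)) / (w + real N)) ^ Suc N) *
    (exp (- real N + (w - 1 / 2) * harm N) * exp (- 1 + (w - 1 / 2) * inverse (real (Suc N))))"
    by (simp only:)
  show ?case
    unfolding prod.lessThan_Suc Suc.IH 1 2 by (simp only: mult_ac)
qed

text \<open>Stirling's formula says that this quotient tends to 1/sqrt(2 pi).\<close>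

definition stirling_quot :: "nat \<Rightarrow> real" where
  "stirling_quot n = real n ^ n * sqrt (real n) * exp (- real n) / fact n"

text \<open>Regroups the quotient into factors with known limits: a product tending to Gamma, a
  power tending to exp w, the harmonic number minus the logarithm, and Stirling's quotient. To this
  end N^(w - 1/2) is split into N^w for \<open>Gamma_series'\<close> and 1/sqrt N for
  \<open>stirling_quot\<close>.\<close>

lemma barnes_shift_quot_eq:
  assumes "N > 0" "1 + w / real N > 0"
  shows "(w + real N) ^ N / pochhammer w N * exp (- real N + (w - 1 / 2) * harm N) =
    Gamma_series' w N * (1 + w / real N) powr real N * exp ((w - 1 / 2) * (harm N - ln (real N)))
      * stirling_quot N"
proof -
  have 1: "(w + real N) ^ N = (1 + w / real N) ^ N * real N ^ N"
    using assms by (simp add: field_simps flip: power_mult_distrib)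
  have 2: "(1 + w / real N) powr real N = (1 + w / real N) ^ N"
    using assms by (simp add: powr_realpow)
  have 3: "exp (- real N + (w - 1 / 2) * harm N) = exp (- real N) *
      exp ((w - 1 / 2) * (harm N - ln (real N))) * exp (w * ln (real N)) / sqrt (real N)"
    using assms by (simp add: powr_half_sqrt [symmetric] powr_def algebra_simps flip: exp_add exp_diff)
  have 4: "fact N = sqrt (real N) * sqrt (real N) * fact (N - 1)"
    using assms(1) by (simp add: fact_reduce)
  have gen: "A * R / p * (e1 * e2 * e3 / s) = f * e3 / p * A * e2 * (R * s * e1 / (s * s * f))"
    if "s \<noteq> 0" "f \<noteq> 0"
    for A R p e1 e2 e3 s f :: real
    using that by (simp add: field_simps)
  have "(1 + w / real N) ^ N * real N ^ N / pochhammer w N * (exp (- real N) *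
      exp ((w - 1 / 2) * (harm N - ln (real N))) * exp (w * ln (real N)) / sqrt (real N)) =
    fact (N - 1) * exp (w * ln (real N)) / pochhammer w N * (1 + w / real N) ^ N *
      exp ((w - 1 / 2) * (harm N - ln (real N))) *
      (real N ^ N * sqrt (real N) * exp (- real N) / (sqrt (real N) * sqrt (real N) * fact (N - 1)))"
    by (rule gen) (use assms(1) in simp_all)
  then show ?thesis
    unfolding Gamma_series'_def stirling_quot_def 1 2 3 4 by (simp only: of_real_eq_id id_apply)
qed

lemma prod_barnes_factor_LIMSEQ: "(\<lambda>N. \<Prod>k<N. barnes_factor z k) \<longlonglongrightarrow> prodinf (barnes_factor z)"
  using convergent_prod_LIMSEQ[OF convergent_prod_barnes_factor[of z]]
  by (simp add: LIMSEQ_lessThan_iff_atMost)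

lemma barnes_shift_factors_tendsto:
  "(\<lambda>N. Gamma_series' w N * (1 + w / real N) powr real N *
     exp ((w - 1 / 2) * (harm N - ln (real N))))
   \<longlonglongrightarrow> Gamma w * exp w * exp ((w - 1 / 2) * euler_mascheroni)"
  by (intro tendsto_intros Gamma_series'_LIMSEQ euler_mascheroni_LIMSEQ
      filterlim_compose[OF tendsto_exp_limit_at_top filterlim_real_sequentially])

text \<open>The Barnes product at \<open>z = 1\<close> already shows that Stirling's quotient has a nonzero limit; its value
  follows by comparing \<open>n\<close> with \<open>2n\<close>.\<close>

lemma stirling_quot_convergent: "\<exists>c. c \<noteq> 0 \<and> stirling_quot \<longlonglongrightarrow> c"
proof -
  define f where "f = (\<lambda>N. Gamma_series' 1 N * (1 + 1 / real N) powr real N *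
     exp ((1 - 1 / 2) * (harm N - ln (real N))))"
  have f: "f \<longlonglongrightarrow> exp 1 * exp (euler_mascheroni / 2)"
    using barnes_shift_factors_tendsto[of 1] by (simp add: f_def)
  have 1: "(1 :: real) \<notin> \<int>\<^sub>\<le>\<^sub>0" by simp
  note prod_barnes_factor_LIMSEQ[of 1]
  \<comment> \<open>For w = 1 the product at w - 1 = 0 is trivial, so the partial product at 1 is
    the shift quotient itself.\<close>
  moreover have "eventually (\<lambda>N. (\<Prod>k<N. barnes_factor 1 k) = f N * stirling_quot N) sequentially"
    using eventually_gt_at_top[of 0]
  proof eventually_elim
    case (elim N)
    then show ?case
      using prod_barnes_factor_shift[OF 1, of N] barnes_shift_quot_eq[of N 1]
      by (simp add: f_def add_pos_nonneg)
  qed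
  ultimately have "(\<lambda>N. f N * stirling_quot N) \<longlonglongrightarrow> prodinf (barnes_factor 1)"
    by (rule Lim_transform_eventually)
  then have "(\<lambda>N. f N * stirling_quot N / f N) \<longlonglongrightarrow> prodinf (barnes_factor 1) / (exp 1 * exp (euler_mascheroni / 2))"
    by (intro tendsto_divide f) auto
  moreover have "eventually (\<lambda>N. f N \<noteq> 0) sequentially"
    using f by (rule tendsto_imp_eventually_ne) simp
  then have "eventually (\<lambda>N. f N * stirling_quot N / f N = stirling_quot N) sequentially"
    by eventually_elim simp
  ultimately have "stirling_quot \<longlonglongrightarrow> prodinf (barnes_factor 1) / (exp 1 * exp (euler_mascheroni / 2))"
    by (rule Lim_transform_eventually)
  moreover have "prodinf (barnes_factor 1) \<noteq> 0"
    by (rule prodinf_nonzero[OF convergent_prod_barnes_factor]) (use barnes_factor_nonzero[of 2] in simp)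
  ultimately show ?thesis by (intro exI conjI) auto
qed

text \<open>Rests on (2n)! = 4^n n! (1/2)_n; the factor (1/2)_n is the denominator of the product
  for Gamma(1/2).\<close>

lemma stirling_quot_duplication:
  assumes "n > 0"
  shows "(stirling_quot n)\<^sup>2 * (sqrt 2 * Gamma_series' (1 / 2) n) = stirling_quot (2 * n)"
proof -
  obtain m where m: "n = Suc m" using assms gr0_conv_Suc by auto
  have 1: "exp (ln (real n) / 2) = sqrt (real n)"
    using assms by (simp add: powr_half_sqrt [symmetric] powr_def)
  have 2: "sqrt (real (2 * n)) = sqrt 2 * sqrt (real n)" by (simp add: real_sqrt_mult)
  have 3: "real (2 * n) ^ (2 * n) = 2 ^ (2 * n) * (real n ^ n)\<^sup>2"
    by (simp add: power_mult_distrib power_mult mult.commute flip: power_mult)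
  have 4: "exp (- real (2 * n)) = (exp (- real n))\<^sup>2"
    by (simp flip: exp_double)
  have 5: "fact n = real n * fact (n - 1)" by (simp add: m)
  have 6: "(sqrt (real n))\<^sup>2 = real n" by simp
  have 7: "pochhammer (1/2::real) n \<noteq> 0"
    using pochhammer_pos[of "1/2::real" n] by linarith
  have "(stirling_quot n)\<^sup>2 * (sqrt 2 * Gamma_series' (1 / 2) n) =
     (real n ^ n)\<^sup>2 * real n * (exp (- real n))\<^sup>2 * sqrt 2 * fact (n - 1) * sqrt (real n) / ((fact n)\<^sup>2 * pochhammer (1/2) n)"
    unfolding stirling_quot_def Gamma_series'_def using 1 6
    by (simp add: power_mult_distrib power_divide)
  also have "\<dots> = (real n ^ n)\<^sup>2 * (exp (- real n))\<^sup>2 * sqrt 2 * sqrt (real n) / (fact n * pochhammer (1/2) n)"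
    using assms unfolding 5 by (simp add: field_simps power2_eq_square)
  also have "\<dots> = stirling_quot (2 * n)"
    unfolding stirling_quot_def 2 3 4 fact_double using 7 by (simp add: field_simps)
  finally show ?thesis .
qed

lemma stirling_quot_tendsto: "stirling_quot \<longlonglongrightarrow> 1 / sqrt (2 * pi)"
proof -
  obtain c where c: "c \<noteq> 0" "stirling_quot \<longlonglongrightarrow> c" using stirling_quot_convergent by blast
  have lim2: "(\<lambda>n. stirling_quot (2 * n)) \<longlonglongrightarrow> c"
    using LIMSEQ_subseq_LIMSEQ[OF c(2), of "\<lambda>n. 2 * n"] by (simp add: strict_mono_def o_def)
  have "(\<lambda>n. (stirling_quot n)\<^sup>2 * (sqrt 2 * Gamma_series' (1 / 2) n)) \<longlonglongrightarrow> c\<^sup>2 * (sqrt 2 * Gamma (1/2))"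
    by (intro tendsto_intros c Gamma_series'_LIMSEQ)
  moreover have "eventually (\<lambda>n. (stirling_quot n)\<^sup>2 * (sqrt 2 * Gamma_series' (1 / 2) n) = stirling_quot (2 * n)) sequentially"
    using eventually_gt_at_top[of 0] by eventually_elim (rule stirling_quot_duplication)
  ultimately have "(\<lambda>n. stirling_quot (2 * n)) \<longlonglongrightarrow> c\<^sup>2 * (sqrt 2 * Gamma (1/2))"
    by (rule Lim_transform_eventually)
  \<comment> \<open>One factor c cancels because the limit is already known to be nonzero.\<close>
  then have "c\<^sup>2 * (sqrt 2 * Gamma (1/2)) = c"
    using lim2 by (rule LIMSEQ_unique)
  then have "c = 1 / sqrt (2 * pi)"
    using c(1) by (simp add: power2_eq_square Gamma_one_half_real real_sqrt_mult field_simps)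
  with c show ?thesis by simp
qed

text \<open>In the limit the shift quotient contributes Gamma w together with exp w, exp ((w - 1/2)
  gamma) and 1/sqrt(2 pi). The last three are exactly offset by the change in the exponential
  prefactors of G.\<close>

lemma Barnes_G_plus1:
  fixes w :: real
  assumes w: "w \<notin> \<int>\<^sub>\<le>\<^sub>0"
  shows "Barnes_G (w + 1) = Gamma w * Barnes_G w"
proof -
  let ?f = "\<lambda>N. Gamma_series' w N * (1 + w / real N) powr real N * exp ((w - 1 / 2) * (harm N - ln (real N)))"
  have "(\<lambda>N. (\<Prod>k<N. barnes_factor (w - 1) k) * (?f N * stirling_quot N)) \<longlonglongrightarrow>
    prodinf (barnes_factor (w - 1)) * (Gamma w * exp w * exp ((w - 1 / 2) * euler_mascheroni) * (1 / sqrt (2 * pi)))"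
    by (intro tendsto_mult prod_barnes_factor_LIMSEQ stirling_quot_tendsto barnes_shift_factors_tendsto)
  moreover have "eventually (\<lambda>N. 1 + w / real N > 0) sequentially" by real_asymp
  with eventually_gt_at_top[of 0]
  have "eventually (\<lambda>N. (\<Prod>k<N. barnes_factor (w - 1) k) * (?f N * stirling_quot N)
      = (\<Prod>k<N. barnes_factor w k)) sequentially"
    by eventually_elim (simp only: prod_barnes_factor_shift[OF w] barnes_shift_quot_eq)
  ultimately have "(\<lambda>N. \<Prod>k<N. barnes_factor w k) \<longlonglongrightarrow>
      prodinf (barnes_factor (w - 1)) * (Gamma w * exp w * exp ((w - 1 / 2) * euler_mascheroni) * (1 / sqrt (2 * pi)))"
    by (rule Lim_transform_eventually)
  then have 1: "prodinf (barnes_factor w) =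
      prodinf (barnes_factor (w - 1)) * (Gamma w * exp w * exp ((w - 1 / 2) * euler_mascheroni) * (1 / sqrt (2 * pi)))"
    by (rule LIMSEQ_unique[OF prod_barnes_factor_LIMSEQ])
  have 2: "exp (w / 2 * ln (2 * pi)) = exp ((w - 1) / 2 * ln (2 * pi)) * sqrt (2 * pi)"
    by (simp add: powr_half_sqrt [symmetric] powr_def field_simps flip: exp_add)
  have 3: "exp (- ((w - 1) * w + euler_mascheroni * (w - 1)\<^sup>2) / 2) =
     exp (- (w * (w + 1) + euler_mascheroni * w\<^sup>2) / 2) * (exp w * exp ((w - 1 / 2) * euler_mascheroni))"
    by (simp add: field_simps power2_eq_square flip: exp_add)
  have 4: "Barnes_G (w + 1) = exp (w / 2 * ln (2 * pi)) *
      exp (- (w * (w + 1) + euler_mascheroni * w\<^sup>2) / 2) * prodinf (barnes_factor w)"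
    using Barnes_G_real[of "w + 1"] by (simp only: add_diff_cancel_right')
  have "(a * s) * e * (P * (g * b * d * (1 / s))) = g * (a * (e * (b * d)) * P)"
    if "s \<noteq> 0" for a b d e g s P :: real
    using that by simp
  then show ?thesis
    unfolding 4 1 2 Barnes_G_real[of w] 3 by simp
qed

subsection \<open>Coefficients and moments of ultraspherical polynomials\<close>

text \<open>The coefficient of \<open>x\<^sup>i\<close> in \<open>C\<^sub>k\<close>.\<close>

definition geg_coeff :: "real \<Rightarrow> nat \<Rightarrow> nat \<Rightarrow> real" where
  "geg_coeff l k i = (if i \<le> k \<and> even (k - i)
     then (- 1) ^ ((k - i) div 2) * pochhammer l (i + (k - i) div 2) * 2 ^ i / (fact i * fact ((k - i) div 2))
     else 0)"

lemma geg_coeff_add [simp]: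
  "geg_coeff l (i + 2 * s) i = (- 1) ^ s * pochhammer l (i + s) * 2 ^ i / (fact i * fact s)"
  by (simp add: geg_coeff_def)

lemma geg_coeff_same: "geg_coeff l k k = pochhammer l k * 2 ^ k / fact k"
  using geg_coeff_add[of l k 0] by simp

lemma geg_coeff_eq_0: "k < i \<or> odd (k + i) \<Longrightarrow> geg_coeff l k i = 0"
  by (auto simp: geg_coeff_def)

text \<open>Coefficient of x^i in the three-term recurrence (k + 2) C_{k+2} = 2 (k + 1 + l) x
  C_{k+1} - (k + 2l) C_k. The cases i = 0 and s = 0 are the boundaries at which one term on the
  right drops out; in each case K is a common factor that leaves a polynomial identity.\<close>

lemma geg_coeff_rec:
  "real (k + 2) * geg_coeff l (k + 2) i =
     2 * (real k + 1 + l) * (if i = 0 then 0 else geg_coeff l (k + 1) (i - 1))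
     - (real k + 2 * l) * geg_coeff l k i"
proof (cases "i \<le> k + 2 \<and> even (k + i)")
  case False
  then show ?thesis by (cases i) (auto simp: geg_coeff_eq_0)
next
  case True
  then have "even (k + 2 - i)" by auto
  then obtain s where "k + 2 - i = 2 * s" by (elim evenE)
  with True have k: "k + 2 = i + 2 * s" by linarith
  have rk: "real k = real i + 2 * real s - 2" using k by linarith
  have c2: "geg_coeff l (k + 2) i = (- 1) ^ s * pochhammer l (i + s) * 2 ^ i / (fact i * fact s)"
    unfolding k by simp
  have c1: "geg_coeff l (k + 1) j = (- 1) ^ s * pochhammer l (j + s) * 2 ^ j / (fact j * fact s)"
    if "i = Suc j" for j
  proof -
    have "k + 1 = j + 2 * s" using k that by simp
    then show ?thesis by (simp only: geg_coeff_add)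
  qed
  have c0: "geg_coeff l k i = (- 1) ^ r * pochhammer l (i + r) * 2 ^ i / (fact i * fact r)"
    if "s = Suc r" for r
  proof -
    have "k = i + 2 * r" using k that by simp
    then show ?thesis by simp
  qed
  show ?thesis
  proof (cases i)
    case i: 0
    then obtain r where s: "s = Suc r" using k by (cases s) auto
    define K where "K = (- 1) ^ r * pochhammer l r / fact s"
    have e2: "geg_coeff l (k + 2) i = - (K * (l + real r))"
      unfolding c2 by (simp add: K_def i s pochhammer_Suc)
    have e0: "geg_coeff l k i = K * real s"
      unfolding c0[OF s] by (simp add: K_def i s field_simps del: of_nat_Suc)
    show ?thesis
      unfolding e2 e0 using rk by (simp add: i s algebra_simps)
  next
    case i: (Suc j)
    show ?thesis
    proof (cases s)
      case s: 0
      then have e0: "geg_coeff l k i = 0" using k by (simp add: geg_coeff_eq_0)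
      define K where "K = pochhammer l j * 2 ^ j / fact i"
      have e2: "geg_coeff l (k + 2) i = K * (2 * (l + real j))"
        unfolding c2 by (simp add: K_def i s pochhammer_Suc del: fact_Suc)
      have e1: "geg_coeff l (k + 1) (i - 1) = K * real i"
        using c1[OF i] by (simp add: K_def i s field_simps del: of_nat_Suc)
      show ?thesis
        unfolding e2 e1 e0 using rk by (simp add: i s algebra_simps)
    next
      case s: (Suc r)
      define K where "K = (- 1) ^ r * pochhammer l (j + s) * 2 ^ j / (fact i * fact s)"
      have "i + s = Suc (j + s)" "i + r = j + s" by (simp_all add: i s)
      then have e2: "geg_coeff l (k + 2) i = - (K * (2 * (l + real j + real s)))"
        unfolding c2 by (simp add: K_def i s pochhammer_Suc add_ac del: fact_Suc)
      have e0: "geg_coeff l k i = K * (2 * real s)"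
        unfolding c0[OF s] \<open>i + r = j + s\<close> by (simp add: K_def i s field_simps del: of_nat_Suc)
      have e1: "geg_coeff l (k + 1) (i - 1) = - (K * real i)"
        using c1[OF i] by (simp add: K_def i s field_simps del: of_nat_Suc)
      show ?thesis
        unfolding e2 e1 e0 using rk by (simp add: i s algebra_simps)
    qed
  qed
qed

text \<open>The integral of \<open>x\<^sup>m (1 - x\<^sup>2)\<close> to the power \<open>l - 1/2\<close> over \<open>[-1,1]\<close>; \<open>geg_moment l k j\<close> below is then
  the inner product of \<open>C\<^sub>k\<close> and \<open>x\<^sup>j\<close>.\<close>

definition geg_weight_moment :: "real \<Rightarrow> nat \<Rightarrow> real" where
  "geg_weight_moment l m = (if even m then Beta ((real m + 1) / 2) (l + 1 / 2) else 0)"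

lemma alpha_entry_eq: "alpha_entry l i j = geg_weight_moment l (i + j)"
  by (simp add: alpha_entry_def geg_weight_moment_def)

definition geg_moment :: "real \<Rightarrow> nat \<Rightarrow> nat \<Rightarrow> real" where
  "geg_moment l k j = (\<Sum>i\<le>k. geg_coeff l k i * geg_weight_moment l (i + j))"

lemma geg_moment_extend:
  "k \<le> n \<Longrightarrow> geg_moment l k j = (\<Sum>i\<le>n. geg_coeff l k i * geg_weight_moment l (i + j))"
  unfolding geg_moment_def by (rule sum.mono_neutral_left) (auto simp: geg_coeff_eq_0)

text \<open>The factor x in the recurrence for C_k is moved to the other argument of the inner
  product, where it turns x^j into x^(j+1).\<close>

lemma geg_moment_rec:
  "real (k + 2) * geg_moment l (k + 2) j =
     2 * (real k + 1 + l) * geg_moment l (k + 1) (j + 1) - (real k + 2 * l) * geg_moment l k j"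
proof -
  let ?c = "\<lambda>i. if i = 0 then 0 else geg_coeff l (k + 1) (i - 1)"
  have "real (k + 2) * geg_moment l (k + 2) j =
      (\<Sum>i\<le>k+2. (real (k + 2) * geg_coeff l (k + 2) i) * geg_weight_moment l (i + j))"
    unfolding geg_moment_def by (simp only: sum_distrib_left mult.assoc)
  also have "\<dots> = 2 * (real k + 1 + l) * (\<Sum>i\<le>k+2. ?c i * geg_weight_moment l (i + j))
      - (real k + 2 * l) * (\<Sum>i\<le>k+2. geg_coeff l k i * geg_weight_moment l (i + j))"
    unfolding geg_coeff_rec left_diff_distrib sum_subtractf sum_distrib_left by (simp only: mult.assoc)
  also have "(\<Sum>i\<le>k+2. geg_coeff l k i * geg_weight_moment l (i + j)) = geg_moment l k j"
    by (rule geg_moment_extend [symmetric]) simp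
  also have "(\<Sum>i\<le>k+2. ?c i * geg_weight_moment l (i + j)) = geg_moment l (k + 1) (j + 1)"
  proof -
    have "k + 2 = Suc (k + 1)" by simp
    then show ?thesis
      unfolding geg_moment_def by (simp only: sum.atMost_Suc_shift) simp
  qed
  finally show ?thesis .
qed

lemma geg_moment_odd: "odd (k + j) \<Longrightarrow> geg_moment l k j = 0"
  unfolding geg_moment_def
  by (rule sum.neutral) (auto simp: geg_coeff_def geg_weight_moment_def)

text \<open>Orthogonality is the vanishing of the product of the \<open>j - i\<close> when \<open>j < k\<close>. The closed form is used only
  for even \<open>j + k\<close>, where \<open>(j - k + 1)/2\<close> is a half-integer and hence not a pole of \<open>\<Gamma>\<close>.\<close>

definition geg_moment_closed :: "real \<Rightarrow> nat \<Rightarrow> nat \<Rightarrow> real" where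
  "geg_moment_closed l k j =
     pochhammer (2 * l) k * (\<Prod>i<k. real j - real i) * Gamma (l + 1 / 2) * Gamma ((real j - real k + 1) / 2)
       / (2 ^ k * fact k * Gamma (l + (real j + real k) / 2 + 1))"

text \<open>Both sides satisfy \<open>geg_moment_rec\<close>, and they agree for k = 0 and k = 1.
  The induction leaves j arbitrary because the recurrence raises j.\<close>

lemma geg_moment_eq:
  assumes l: "l > - 1 / 2"
  shows "even (k + j) \<Longrightarrow> geg_moment l k j = geg_moment_closed l k j"
proof (induction k arbitrary: j rule: induct_nat_012)
  case 0
  have "(1 + real j) / 2 + (l + 1 / 2) = l + real j / 2 + 1" by (simp add: field_simps)
  with 0 show ?case
    by (simp add: geg_moment_def geg_moment_closed_def geg_weight_moment_def geg_coeff_same Beta_def add_ac)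
next
  case 1
  then have "odd j" by simp
  then have "real j / 2 > 0" by (auto elim: oddE)
  then have "real j / 2 \<notin> \<int>\<^sub>\<le>\<^sub>0" by (auto elim!: nonpos_Ints_cases)
  then have 1: "Gamma (real j / 2 + 1) = real j / 2 * Gamma (real j / 2)" by (rule Gamma_plus1)
  have 2: "(real (Suc j) + 1) / 2 = real j / 2 + 1" by (simp add: field_simps)
  have 3: "real j / 2 + 1 + (l + 1 / 2) = l + (real j + 1) / 2 + 1" by (simp add: field_simps)
  have 4: "geg_coeff l (Suc 0) 0 = 0" by (simp add: geg_coeff_eq_0)
  have "geg_moment l (Suc 0) j = 2 * l * geg_weight_moment l (Suc j)"
    by (simp add: geg_moment_def 4 geg_coeff_same)
  also have "geg_weight_moment l (Suc j) = Beta (real j / 2 + 1) (l + 1 / 2)"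
    using \<open>odd j\<close> by (simp add: geg_weight_moment_def 2 del: of_nat_Suc)
  finally show ?case
    unfolding Beta_def 1 3 by (simp add: geg_moment_closed_def)
next
  case (ge2 k)
  define f where "f = (\<Prod>i<k. real j - real i)"
  define G where "G = Gamma ((real j - real k - 1) / 2)"
  define H where "H = Gamma (l + (real j + real k) / 2 + 1)"
  define P where "P = pochhammer (2 * l) k"
  define y where "y = l + (real j + real k) / 2 + 1"
  have y: "y > 0" using l by (simp add: y_def add_divide_distrib add_pos_nonneg)
  have H: "H > 0" using y unfolding H_def y_def by (rule Gamma_real_pos)
  have ev: "even (k + j)" using ge2.prems by simp
  have IH1: "geg_moment l (k + 1) (j + 1) = geg_moment_closed l (k + 1) (j + 1)"
    using ge2.IH(2)[of "j + 1"] ev by simp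
  have IH0: "geg_moment l k j = geg_moment_closed l k j"
    using ge2.IH(1)[of j] ev by simp
  \<comment> \<open>For even j - k this is a half-integer, so the functional equation of Gamma
    applies even where the argument is negative.\<close>
  have "(real j - real k - 1) / 2 \<notin> \<int>\<^sub>\<le>\<^sub>0"
  proof
    assume "(real j - real k - 1) / 2 \<in> \<int>\<^sub>\<le>\<^sub>0"
    then obtain m :: int where "(real j - real k - 1) / 2 = of_int m" by (elim nonpos_Ints_cases)
    then have "real_of_int (int j - int k - 1) = of_int (2 * m)" by (simp add: field_simps)
    then have "int j - int k - 1 = 2 * m" by (simp only: of_int_eq_iff)
    then have "odd (int j - int k)" by presburger
    with ev show False by simp
  qed
  then have G1: "Gamma ((real j - real k + 1) / 2) = (real j - real k - 1) / 2 * G"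
    unfolding G_def by (subst Gamma_plus1 [symmetric]) (simp_all add: field_simps)
  have H1: "Gamma (y + 1) = y * H"
    using y unfolding H_def y_def by (intro Gamma_plus1) (auto elim!: nonpos_Ints_cases)
  have f1: "(\<Prod>i<k+1. real (j + 1) - real i) = (real j + 1) * f"
    unfolding f_def by (simp add: prod.lessThan_Suc_shift del: prod.lessThan_Suc)
  have f2: "(\<Prod>i<k+2. real j - real i) = f * (real j - real k) * (real j - real k - 1)"
    unfolding f_def by (simp add: algebra_simps)
  have e0: "geg_moment_closed l k j = P * f * Gamma (l + 1 / 2) * ((real j - real k - 1) / 2 * G) / (2 ^ k * fact k * H)"
    unfolding geg_moment_closed_def G1 by (simp only: f_def P_def H_def)
  have e1: "geg_moment_closed l (k + 1) (j + 1) = P * (2 * l + real k) * ((real j + 1) * f) * Gamma (l + 1 / 2)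
      * ((real j - real k - 1) / 2 * G) / (2 ^ k * 2 * ((real k + 1) * fact k) * (y * H))"
  proof -
    have "(real (j + 1) - real (k + 1) + 1) / 2 = (real j - real k + 1) / 2" by simp
    moreover have "l + (real (j + 1) + real (k + 1)) / 2 + 1 = y + 1" by (simp add: y_def field_simps)
    ultimately show ?thesis
      unfolding geg_moment_closed_def f1 by (simp only: G1 H1) (simp add: P_def pochhammer_Suc)
  qed
  have e2: "geg_moment_closed l (k + 2) j = P * (2 * l + real k) * (2 * l + real k + 1) * (f * (real j - real k) * (real j - real k - 1))
      * Gamma (l + 1 / 2) * G / (2 ^ k * 4 * ((real k + 2) * ((real k + 1) * fact k)) * (y * H))"
  proof -
    have "(real j - real (k + 2) + 1) / 2 = (real j - real k - 1) / 2" by simp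
    moreover have "l + (real j + real (k + 2)) / 2 + 1 = y + 1" by (simp add: y_def field_simps)
    ultimately show ?thesis
      unfolding geg_moment_closed_def f2 by (simp only: G_def [symmetric] H1) (simp add: P_def pochhammer_Suc add_ac)
  qed
  \<comment> \<open>The common factor of the three terms of the recurrence; what remains after
    dividing by it is the polynomial identity \<open>p\<close>.\<close>
  define K where "K = P * f * Gamma (l + 1 / 2) * (real j - real k - 1) * G / (2 ^ k * 4 * (real k + 1) * fact k * y * H)"
  have a2: "real (k + 2) * geg_moment_closed l (k + 2) j = K * ((2 * l + real k) * (2 * l + real k + 1) * (real j - real k))"
  proof -
    have "c * (P * a * b * (f * u * v) * g * G / (q * 4 * (c * (d * F)) * (y * H))) =
        P * f * g * v * G / (q * 4 * d * F * y * H) * (a * b * u)"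
      if "c \<noteq> 0" for c a b u v g q d F :: real
      using that by (simp add: mult_ac)
    then show ?thesis
      unfolding e2 K_def of_nat_add of_nat_numeral by this simp
  qed
  have a1: "geg_moment_closed l (k + 1) (j + 1) = K * ((2 * l + real k) * (real j + 1))"
    unfolding e1 K_def by (simp add: mult_ac)
  have a0: "geg_moment_closed l k j = K * (2 * (real k + 1) * y)"
  proof -
    have "P * f * g * (v / 2 * G) / (q * F * H) = P * f * g * v * G / (q * 4 * d * F * y * H) * (2 * d * y)"
      if "d \<noteq> 0" for d g v q F :: real
      using that y by (simp add: mult_ac)
    then show ?thesis
      unfolding e0 K_def by this simp
  qed
  have p: "(2 * l + real k) * (2 * l + real k + 1) * (real j - real k) =
     2 * (real k + 1 + l) * ((2 * l + real k) * (real j + 1)) - (real k + 2 * l) * (2 * (real k + 1) * y)"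
    unfolding y_def by (simp add: field_simps)
  have "real (k + 2) * geg_moment_closed l (k + 2) j = real (k + 2) * geg_moment l (k + 2) j"
    unfolding geg_moment_rec IH0 IH1 a2 a1 a0 p by (simp only: right_diff_distrib mult_ac)
  then show ?case by simp
qed

lemma geg_moment_orthogonal:
  assumes "l > - 1 / 2" "j < k"
  shows "geg_moment l k j = 0"
  using assms geg_moment_eq[of l k j] geg_moment_odd[of k j l]
  by (cases "even (k + j)") (auto simp: geg_moment_closed_def)

lemma geg_moment_same:
  assumes "l > - 1 / 2"
  shows "geg_moment l k k = pochhammer (2 * l) k * Gamma (l + 1 / 2) * sqrt pi / (2 ^ k * Gamma (l + real k + 1))"
proof -
  have "(\<Prod>i<k. real k - real i) = (\<Prod>i<k. real (k - i))" by (rule prod.cong) (auto simp: of_nat_diff)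
  also have "\<dots> = fact k"
    unfolding fact_prod_rev by (simp add: atLeast0LessThan)
  finally show ?thesis
    using geg_moment_eq[OF assms, of k k] by (simp add: geg_moment_closed_def Gamma_one_half_real)
qed

section \<open>Values of ultraspherical polynomials at 0\<close>

lemma pochhammer_minus_of_nat:
  "m \<le> n \<Longrightarrow> pochhammer (- real n) m = (- 1) ^ m * fact n / fact (n - m)"
proof (induction m)
  case (Suc m)
  then have "n - m = Suc (n - Suc m)" by simp
  then have "fact (n - m) = real (n - m) * fact (n - Suc m)" by simp
  with Suc show ?case
    by (simp add: pochhammer_Suc field_simps of_nat_diff)
qed simp

text \<open>The m-th term of the hypergeometric series at x = 0, including the prefactor: (2l)_n (2l
  + n)_m is merged into (2l)_{n+m}, and (-n)_m / n! into (-1)^m / (n - m)!.\<close>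

definition ultraspherical_term :: "real \<Rightarrow> nat \<Rightarrow> nat \<Rightarrow> real" where
  "ultraspherical_term l n m = (if m \<le> n
     then pochhammer (2 * l) (n + m) * (- 1 / 2) ^ m / (fact (n - m) * fact m * pochhammer (l + 1 / 2) m)
     else 0)"

lemma ultraspherical_term_eq_0: "n < m \<Longrightarrow> ultraspherical_term l n m = 0"
  by (simp add: ultraspherical_term_def)

text \<open>The bound N is kept free so that different degrees can be summed over one common
  range.\<close>

lemma ultraspherical_0_eq_sum:
  assumes "n \<le> N"
  shows "ultraspherical n l 0 = (\<Sum>m\<le>N. ultraspherical_term l n m)"
proof -
  let ?h = "\<lambda>m. pochhammer (- real n) m * pochhammer (2 * l + real n) m / pochhammer (l + 1 / 2) m * ((1 - 0) / 2) ^ m / fact m"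
  have "?h m = 0" if "m \<notin> {..N}" for m
    using that assms by (simp add: pochhammer_of_nat_eq_0_iff)
  then have "hyp2F1 (- real n) (2 * l + real n) (l + 1 / 2) ((1 - 0) / 2) = (\<Sum>m\<le>N. ?h m)"
    unfolding hyp2F1_def by (intro suminf_finite) auto
  moreover have "pochhammer (2 * l) n / fact n * ?h m = ultraspherical_term l n m" for m
  proof (cases "m \<le> n")
    case True
    have "pochhammer (2 * l) n * pochhammer (2 * l + real n) m = pochhammer (2 * l) (n + m)"
      using pochhammer_product'[of "2 * l" n m] by simp
    moreover have "(- 1 :: real) ^ m * (1 / 2) ^ m = (- 1 / 2) ^ m"
      by (simp flip: power_mult_distrib)
    ultimately show ?thesis
      using True by (simp add: ultraspherical_term_def pochhammer_minus_of_nat field_simps)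
  next
    case False
    then show ?thesis by (simp add: ultraspherical_term_def pochhammer_of_nat_eq_0_iff)
  qed
  ultimately show ?thesis
    unfolding ultraspherical_def by (simp only: sum_distrib_left)
qed

text \<open>The value at \<open>z = 1/2\<close>, that is \<open>x = 1 - 2z = 0\<close>, of the termwise three-term recurrence in powers of \<open>z\<close>:
  the term with \<open>x\<close> becomes a difference, which telescopes in the sum over \<open>m\<close>.\<close>

lemma ultraspherical_term_rec:
  assumes l: "l > - 1 / 2"
  shows "real (n + 2) * ultraspherical_term l (n + 2) m + (real n + 2 * l) * ultraspherical_term l n m =
     2 * (real n + 1 + l) * (ultraspherical_term l (n + 1) m - (if m = 0 then 0 else ultraspherical_term l (n + 1) (m - 1)))"
proof -
  define p where "p = pochhammer (2 * l) (n + m)"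
  have p1: "pochhammer (2 * l) (n + 1 + m) = p * (2 * l + real n + real m)"
    by (simp add: p_def pochhammer_Suc add_ac)
  have p2: "pochhammer (2 * l) (n + 2 + m) = p * (2 * l + real n + real m) * (2 * l + real n + real m + 1)"
    by (simp add: p_def pochhammer_Suc add_ac)
  \<comment> \<open>\<open>1/(k - m)!\<close>, extended by \<open>0\<close>: its recurrence then holds for all \<open>k\<close>, also across \<open>k = m\<close>\<close>
  define R :: "nat \<Rightarrow> real" where "R = (\<lambda>n. if m \<le> n then 1 / fact (n - m) else 0)"
  have R: "R k = (real k + 1 - real m) * R (k + 1)" for k
    by (auto simp: R_def Suc_diff_le of_nat_diff field_simps not_le less_Suc_eq_le le_Suc_eq)
  define K where "K = p * (- 1 / 2) ^ m * R (n + 2) / (fact m * pochhammer (l + 1 / 2) m)"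
  have R1: "R (n + 1) = (real n + 2 - real m) * R (n + 2)"
    using R[of "n + 1"] by (simp add: add_ac)
  have R0: "R n = (real n + 2 - real m) * (real n + 1 - real m) * R (n + 2)"
    using R[of n] unfolding R1 by simp
  have t: "ultraspherical_term l k m = pochhammer (2 * l) (k + m) * (- 1 / 2) ^ m * R k / (fact m * pochhammer (l + 1 / 2) m)" for k
    by (simp add: ultraspherical_term_def R_def)
  have t2: "ultraspherical_term l (n + 2) m = K * ((2 * l + real n + real m) * (2 * l + real n + real m + 1))"
    unfolding t p2 by (simp add: K_def)
  have t1: "ultraspherical_term l (n + 1) m = K * ((2 * l + real n + real m) * (real n + 2 - real m))"
    unfolding t p1 R1 by (simp add: K_def)
  have t0: "ultraspherical_term l n m = K * ((real n + 2 - real m) * (real n + 1 - real m))"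
    unfolding t p_def [symmetric] R0 by (simp add: K_def)
  \<comment> \<open>The factor m on the right lets one formula cover m = 0 as well.\<close>
  have s1: "(if m = 0 then 0 else ultraspherical_term l (n + 1) (m - 1)) = - (K * (2 * real m * (l + real m - 1 / 2)))"
  proof (cases m)
    case m: (Suc k)
    define q where "q = pochhammer (l + 1 / 2) k"
    have "l + real m - 1 / 2 \<noteq> 0" using l by (simp add: m)
    moreover have "pochhammer (l + 1 / 2) m = q * (l + real m - 1 / 2)"
      by (simp add: q_def m pochhammer_Suc)
    moreover have "ultraspherical_term l (n + 1) k = p * (- 1 / 2) ^ k * R (n + 2) / (fact k * q)"
      by (simp add: ultraspherical_term_def R_def m p_def q_def)
    moreover have "fact m = real m * fact k" "real m \<noteq> 0" by (simp_all add: m)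
    moreover have "(- 1 / 2 :: real) ^ m = - 1 / 2 * (- 1 / 2) ^ k" by (simp add: m)
    ultimately show ?thesis by (simp add: K_def m del: fact_Suc of_nat_Suc power_Suc)
  qed simp
  show ?thesis
    unfolding t2 t1 t0 s1 by (simp add: algebra_simps)
qed

lemma sum_backward_difference:
  "(\<Sum>m\<le>M. f m - (if m = 0 then 0 else f (m - 1))) = f M" for f :: "nat \<Rightarrow> 'a :: ab_group_add"
  by (induction M) auto

text \<open>After telescoping only the term of index n + 2 in degree n + 1 is left, and it lies
  beyond the end of that series.\<close>

lemma ultraspherical_0_rec:
  assumes "l > - 1 / 2"
  shows "real (n + 2) * ultraspherical (n + 2) l 0 = - (real n + 2 * l) * ultraspherical n l 0"
proof -
  have "real (n + 2) * ultraspherical (n + 2) l 0 + (real n + 2 * l) * ultraspherical n l 0 =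
    (\<Sum>m\<le>n+2. real (n + 2) * ultraspherical_term l (n + 2) m + (real n + 2 * l) * ultraspherical_term l n m)"
    using ultraspherical_0_eq_sum[of "n + 2" "n + 2" l] ultraspherical_0_eq_sum[of n "n + 2" l]
    by (simp only: sum_distrib_left sum.distrib le_refl le_add1)
  also have "\<dots> = 2 * (real n + 1 + l) * ultraspherical_term l (n + 1) (n + 2)"
    unfolding ultraspherical_term_rec[OF assms] by (simp only: sum_backward_difference flip: sum_distrib_left)
  also have "\<dots> = 0" by (simp add: ultraspherical_term_eq_0)
  finally show ?thesis by (simp add: algebra_simps)
qed

text \<open>The hypergeometric form does not display the parity of the polynomials. The vanishing in
  odd degree comes from degree 1 through the two-step recurrence.\<close>

lemma ultraspherical_at_0:
  assumes l: "l > - 1 / 2"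
  shows "ultraspherical n l 0 =
    (if even n then (- 1) ^ (n div 2) * pochhammer l (n div 2) / fact (n div 2) else 0)"
proof (induction n rule: induct_nat_012)
  case 0
  show ?case using ultraspherical_0_eq_sum[of 0 0 l] by (simp add: ultraspherical_term_def)
next
  case 1
  have "l + 1 / 2 \<noteq> 0" using l by linarith
  then show ?case using ultraspherical_0_eq_sum[of 1 1 l]
    by (simp add: ultraspherical_term_def pochhammer_Suc field_simps eval_nat_numeral)
next
  case (ge2 n)
  have rec: "ultraspherical (n + 2) l 0 = - (real n + 2 * l) / real (n + 2) * ultraspherical n l 0"
    using ultraspherical_0_rec[OF l, of n] by (simp add: field_simps)
  show ?case
  proof (cases "even n")
    case True
    then obtain s where n: "n = 2 * s" by (elim evenE)
    have "- (real n + 2 * l) / real (n + 2) = - ((l + real s) / (real s + 1))"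
      unfolding n by (simp add: divide_simps) (simp add: algebra_simps)
    moreover have "Suc (Suc n) div 2 = Suc s" "n div 2 = s" by (simp_all add: n)
    ultimately show ?thesis
      using rec True ge2.IH(1) by (simp add: pochhammer_Suc mult_ac add_ac)
  next
    case False
    then show ?thesis using rec ge2.IH(1) by simp
  qed
qed

text \<open>This is Taylor's formula at 0, as the derivative of C_k with parameter l is 2l times
  C_{k-1} with parameter l + 1. It is checked here on the closed forms, using (l)_i (l + i)_s =
  (l)_{i+s}.\<close>

lemma geg_coeff_conv_ultraspherical:
  assumes "l > - 1 / 2" "i \<le> k"
  shows "geg_coeff l k i = 2 ^ i * pochhammer l i / fact i * ultraspherical (k - i) (l + real i) 0"
proof -
  have "l + real i > - 1 / 2" using assms by linarith
  then show ?thesis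
    using assms pochhammer_product'[of l i "(k - i) div 2"]
    by (simp add: geg_coeff_def ultraspherical_at_0 mult_ac)
qed

subsection \<open>Determinant and inverse of the moment matrix\<close>

lemma Gamma_legendre_duplication_real:
  fixes x :: real
  assumes "x \<notin> \<int>\<^sub>\<le>\<^sub>0" "x + 1 / 2 \<notin> \<int>\<^sub>\<le>\<^sub>0"
  shows "Gamma x * Gamma (x + 1 / 2) = 2 powr (1 - 2 * x) * sqrt pi * Gamma (2 * x)"
proof -
  have "complex_of_real x + 1 / 2 = complex_of_real (x + 1 / 2)" by simp
  then have "complex_of_real x + 1 / 2 \<notin> \<int>\<^sub>\<le>\<^sub>0"
    using assms(2) by (simp only: of_real_in_nonpos_Ints_iff) simp
  moreover have "complex_of_real x \<notin> \<int>\<^sub>\<le>\<^sub>0"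
    using assms(1) by (simp only: of_real_in_nonpos_Ints_iff) simp
  ultimately have "Gamma (complex_of_real x) * Gamma (complex_of_real x + 1 / 2) =
      exp ((1 - 2 * complex_of_real x) * of_real (ln 2)) * of_real (sqrt pi) * Gamma (2 * complex_of_real x)"
    by (intro Gamma_legendre_duplication)
  also have "exp ((1 - 2 * complex_of_real x) * of_real (ln 2)) = of_real (2 powr (1 - 2 * x))"
    by (simp add: powr_def mult.commute flip: exp_of_real)
  also have "2 * complex_of_real x = of_real (2 * x)" by simp
  also have "complex_of_real x + 1 / 2 = complex_of_real (x + 1 / 2)" by simp
  finally show ?thesis
    unfolding Gamma_complex_of_real by (simp only: of_real_mult [symmetric] of_real_eq_iff)
qed

text \<open>For l > -1/2 both l and 2l exceed -1, so 0 is the only pole of Gamma that they can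
  meet.\<close>

lemma not_nonpos_Ints_of_gt_minus_one:
  fixes x :: real
  assumes "x > - 1" "x \<noteq> 0"
  shows "x \<notin> \<int>\<^sub>\<le>\<^sub>0"
proof
  assume "x \<in> \<int>\<^sub>\<le>\<^sub>0"
  then obtain m where m: "x = of_int m" "m \<le> 0" by (elim nonpos_Ints_cases)
  with assms(1) have "m > - 1" by linarith
  with m assms(2) show False by simp
qed

lemma
  fixes l :: real
  assumes "l > - 1 / 2" "l \<noteq> 0"
  shows parameter_not_nonpos_Int: "l \<notin> \<int>\<^sub>\<le>\<^sub>0" "2 * l \<notin> \<int>\<^sub>\<le>\<^sub>0" "l + 1 / 2 \<notin> \<int>\<^sub>\<le>\<^sub>0"
    and parameter_pochhammer_nonzero: "pochhammer l k \<noteq> 0" "pochhammer (2 * l) k \<noteq> 0"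
proof -
  show 1: "l \<notin> \<int>\<^sub>\<le>\<^sub>0" "2 * l \<notin> \<int>\<^sub>\<le>\<^sub>0" "l + 1 / 2 \<notin> \<int>\<^sub>\<le>\<^sub>0"
    by (rule not_nonpos_Ints_of_gt_minus_one; use assms in simp)+
  show "pochhammer l k \<noteq> 0" "pochhammer (2 * l) k \<noteq> 0"
    using 1 pochhammer_eq_0_imp_nonpos_Int by blast+
qed

lemma Gamma_add_of_nat_Suc:
  fixes l :: real
  assumes "l > - 1 / 2" "l \<noteq> 0"
  shows "Gamma (l + real k + 1) = (l + real k) * (pochhammer l k * Gamma l)"
proof -
  have "l + real k \<notin> \<int>\<^sub>\<le>\<^sub>0"
    by (rule not_nonpos_Ints_of_gt_minus_one) (use assms in \<open>cases k; auto\<close>)+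
  moreover have "pochhammer l k = Gamma (l + real k) / Gamma l"
    by (rule pochhammer_Gamma[OF parameter_not_nonpos_Int(1)[OF assms]])
  ultimately show ?thesis
    using parameter_not_nonpos_Int(1)[OF assms] by (simp add: Gamma_plus1 Gamma_eq_zero_iff)
qed

text \<open>The squared norm of C_k: by orthogonality only the leading term of one of the two
  factors contributes.\<close>

definition geg_norm :: "real \<Rightarrow> nat \<Rightarrow> real" where
  "geg_norm l k = geg_moment l k k * geg_coeff l k k"

lemma geg_norm_eq:
  assumes "l > - 1 / 2" "l \<noteq> 0"
  shows "geg_norm l k = pochhammer (2 * l) k * sqrt pi * Gamma (l + 1 / 2) / (fact k * (l + real k) * Gamma l)"
  unfolding geg_norm_def geg_coeff_same geg_moment_same[OF assms(1)] Gamma_add_of_nat_Suc[OF assms]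
  using parameter_pochhammer_nonzero(1)[OF assms, of k] by (simp add: mult_ac)

lemma geg_norm_nonzero:
  assumes "l > - 1 / 2" "l \<noteq> 0"
  shows "geg_norm l k \<noteq> 0"
proof -
  have "l + real k \<noteq> 0" using assms by (cases k) auto
  then show ?thesis
    unfolding geg_norm_eq[OF assms]
    using parameter_pochhammer_nonzero(2)[OF assms, of k] parameter_not_nonpos_Int[OF assms] by (simp add: Gamma_eq_zero_iff)
qed

lemma geg_coeff_same_nonzero:
  assumes "l > - 1 / 2" "l \<noteq> 0"
  shows "geg_coeff l k k \<noteq> 0"
  unfolding geg_coeff_same using parameter_pochhammer_nonzero(1)[OF assms, of k] by simp

definition det_Gamma_factor :: "real \<Rightarrow> nat \<Rightarrow> real" where
  "det_Gamma_factor l k = pi * fact k * Gamma (2 * l + real k) /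
        ((l + real k) * 2 powr (2 * l + 2 * real k - 1) * (Gamma (l + real k))\<^sup>2)"

text \<open>The left side is a diagonal entry of C \<alpha> over the one of C, that is, a pivot of
  \<alpha>. Legendre's duplication formula replaces Gamma(l + 1/2) by Gamma(2l) and a power of
  2.\<close>

lemma pivot_eq_det_Gamma_factor:
  assumes "l > - 1 / 2" "l \<noteq> 0"
  shows "geg_moment l k k / geg_coeff l k k = det_Gamma_factor l k"
proof -
  note np = parameter_not_nonpos_Int[OF assms]
  define a where "a = Gamma l"
  define q where "q = pochhammer l k"
  define r where "r = (2 :: real) powr (2 * l - 1)"
  define s where "s = sqrt pi"
  have nz: "a \<noteq> 0" "q \<noteq> 0" "r \<noteq> 0" "s \<noteq> 0" "l + real k \<noteq> 0"
    using np parameter_pochhammer_nonzero[OF assms] assms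
    by (auto simp: a_def q_def r_def s_def Gamma_eq_zero_iff) (cases k; auto)
  have ss: "pi = s * s" by (simp add: s_def)
  have 1: "Gamma (2 * l + real k) = pochhammer (2 * l) k * Gamma (2 * l)"
    using np by (simp add: pochhammer_Gamma Gamma_eq_zero_iff)
  have 2: "Gamma (l + real k) = q * a"
    using np by (simp add: pochhammer_Gamma Gamma_eq_zero_iff a_def q_def)
  have "2 powr (1 - 2 * l) = 1 / r" by (simp add: r_def powr_diff)
  then have 3: "Gamma (l + 1 / 2) = s * Gamma (2 * l) / (a * r)"
    using Gamma_legendre_duplication_real[OF np(1,3)] nz by (simp add: a_def s_def field_simps)
  have 4: "2 powr (2 * l + 2 * real k - 1) = r * (2 ^ k * 2 ^ k)"
  proof -
    have "2 powr (2 * l + 2 * real k - 1) = 2 powr (2 * l - 1) * 2 powr real k * 2 powr real k"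
      by (simp add: algebra_simps flip: powr_add)
    then show ?thesis by (simp add: r_def powr_realpow)
  qed
  show ?thesis
    unfolding geg_coeff_same geg_moment_same[OF assms(1)] Gamma_add_of_nat_Suc[OF assms] det_Gamma_factor_def
      1 2 3 4 a_def [symmetric] q_def [symmetric] s_def [symmetric] power2_eq_square
    unfolding ss using nz by (simp add: mult_ac)
qed

lemma det_Gamma_form_eq: "det_Gamma_form l n = (\<Prod>k\<le>n. det_Gamma_factor l k)"
  by (simp add: det_Gamma_form_def det_Gamma_factor_def atMost_atLeast0)

section \<open>From Gamma products to Barnes functions\<close>

lemma Gamma_shift_prod:
  fixes x :: real
  assumes "x \<notin> \<int>\<^sub>\<le>\<^sub>0"
  shows "(\<Prod>k\<le>n. Gamma (x + real k)) * Barnes_G x = Barnes_G (x + real n + 1)"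
proof (induction n)
  case 0
  then show ?case using Barnes_G_plus1[OF assms] by simp
next
  case (Suc n)
  have "x + real (Suc n) \<notin> \<int>\<^sub>\<le>\<^sub>0"
    using assms by (metis add_diff_cancel_right' nonpos_Ints_diff_Nats of_nat_in_Nats)
  from Barnes_G_plus1[OF this] Suc show ?case by (simp add: add_ac mult_ac)
qed

lemma fact_prod_Barnes_G: "(\<Prod>k\<le>n. fact k :: real) = Barnes_G (real n + 2)"
proof -
  have "(\<Prod>k\<le>n. fact k :: real) = (\<Prod>k\<le>n. Gamma (1 + real k))"
    by (simp add: Gamma_fact)
  also have "\<dots> = Barnes_G (1 + real n + 1)"
    using Gamma_shift_prod[of 1 n] by simp
  finally show ?thesis by (simp add: add_ac)
qed

lemma prod_two_powr: "(\<Prod>k\<le>n. 2 powr (2 * l + 2 * real k - 1)) = 2 powr ((real n + 1) * (real n + 2 * l - 1))"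
  by (induction n) (simp_all add: algebra_simps flip: powr_add)

text \<open>Each product of Gamma values telescopes to a quotient of values of G; the hypotheses on
  l keep the denominators G(l) and G(2l) away from zero.\<close>

lemma det_Barnes_form_eq:
  assumes "l > - 1 / 2" "l \<noteq> 0"
  shows "det_Barnes_form l n = det_Gamma_form l n"
proof -
  note np = parameter_not_nonpos_Int[OF assms]
  have "det_Gamma_form l n = pi ^ (n + 1) * (\<Prod>k\<le>n. fact k) * (\<Prod>k\<le>n. Gamma (2 * l + real k)) /
     ((\<Prod>k\<le>n. l + real k) * (\<Prod>k\<le>n. 2 powr (2 * l + 2 * real k - 1)) * (\<Prod>k\<le>n. Gamma (l + real k))\<^sup>2)"
    by (simp add: det_Gamma_form_eq det_Gamma_factor_def prod.distrib prod_dividef prod_power_distrib)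
  also have "(\<Prod>k\<le>n. fact k :: real) = Barnes_G (real n + 2)" by (rule fact_prod_Barnes_G)
  also have "(\<Prod>k\<le>n. Gamma (2 * l + real k)) = Barnes_G (2 * l + real n + 1) / Barnes_G (2 * l)"
    using Gamma_shift_prod[OF np(2), of n] Barnes_G_nonzero[OF np(2)] by (simp add: field_simps)
  also have "(\<Prod>k\<le>n. Gamma (l + real k)) = Barnes_G (l + real n + 1) / Barnes_G l"
    using Gamma_shift_prod[OF np(1), of n] Barnes_G_nonzero[OF np(1)] by (simp add: field_simps)
  also have "(\<Prod>k\<le>n. l + real k) = pochhammer l (n + 1)"
    by (simp add: pochhammer_prod lessThan_Suc_atMost flip: lessThan_atLeast0)
  also note prod_two_powr
  finally show ?thesis
    unfolding det_Barnes_form_def by (simp add: power_divide mult_ac)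
qed

section \<open>Triangular factorisation of the moment matrix\<close>

definition geg_mat :: "real \<Rightarrow> nat \<Rightarrow> real mat" where
  "geg_mat l n = mat (n + 1) (n + 1) (\<lambda>(k, i). geg_coeff l k i)"

lemma mat_carriers [simp, intro]:
  "geg_mat l n \<in> carrier_mat (n + 1) (n + 1)"
  "alpha_mat l n \<in> carrier_mat (n + 1) (n + 1)"
  "beta_mat l n \<in> carrier_mat (n + 1) (n + 1)"
  by (simp_all add: geg_mat_def alpha_mat_def beta_mat_def)

lemma mat_mult_mat_eq:
  "mat a b f * mat b c g = mat a c (\<lambda>(i, j). \<Sum>k<b. f (i, k) * g (k, j))"
  by (rule eq_matI) (simp_all add: scalar_prod_def atLeast0LessThan)

lemma geg_mat_times_alpha_mat:
  "geg_mat l n * alpha_mat l n = mat (n + 1) (n + 1) (\<lambda>(k, j). geg_moment l k j)"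
  unfolding geg_mat_def alpha_mat_def mat_mult_mat_eq
  by (rule eq_matI) (simp_all add: alpha_entry_eq geg_moment_extend[of _ n] lessThan_Suc_atMost less_Suc_eq_le)

text \<open>C and C \<alpha> are triangular in opposite senses, so both determinants are products of
  diagonal entries, and their quotient is the product of the pivots.\<close>

lemma det_alpha_mat:
  assumes "l > - 1 / 2" "l \<noteq> 0"
  shows "det (alpha_mat l n) = det_Gamma_form l n"
proof -
  have "det (geg_mat l n) = prod_list (diag_mat (geg_mat l n))"
    by (rule det_lower_triangular[of "n + 1"]) (auto simp: geg_mat_def geg_coeff_eq_0)
  also have "\<dots> = (\<Prod>k\<le>n. geg_coeff l k k)"
    by (simp add: diag_mat_def geg_mat_def prod.list_conv_set_nth atLeast0LessThan lessThan_Suc_atMost del: upt_Suc)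
  finally have C: "det (geg_mat l n) = (\<Prod>k\<le>n. geg_coeff l k k)" .
  have "det (geg_mat l n) * det (alpha_mat l n) = det (geg_mat l n * alpha_mat l n)"
    by (rule det_mult [symmetric]) auto
  also have "\<dots> = prod_list (diag_mat (geg_mat l n * alpha_mat l n))"
    unfolding geg_mat_times_alpha_mat using assms(1)
    by (intro det_upper_triangular[of _ "n + 1"]) (auto simp: geg_moment_orthogonal upper_triangular_def)
  also have "\<dots> = (\<Prod>k\<le>n. geg_moment l k k)"
    unfolding geg_mat_times_alpha_mat
    by (simp add: diag_mat_def prod.list_conv_set_nth atLeast0LessThan lessThan_Suc_atMost del: upt_Suc)
  finally have "det (alpha_mat l n) = (\<Prod>k\<le>n. geg_moment l k k / geg_coeff l k k)"
    unfolding C using geg_coeff_same_nonzero[OF assms] by (simp add: prod_dividef field_simps)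
  then show ?thesis
    by (simp add: det_Gamma_form_eq pivot_eq_det_Gamma_factor[OF assms])
qed

lemma geg_orthogonality:
  assumes "l > - 1 / 2" "k \<le> n" "m \<le> n"
  shows "(\<Sum>i\<le>n. geg_coeff l m i * geg_moment l k i) = (if m = k then geg_norm l k else 0)"
proof -
  have *: "(\<Sum>i\<le>n. geg_coeff l m i * geg_moment l k i) = (if m = k then geg_norm l k else 0)"
    if "m \<le> k" "k \<le> n" for m k
  proof -
    \<comment> \<open>The moment vanishes for i < k and the coefficient for i > k, since m does not
      exceed k.\<close>
    have "geg_coeff l m i * geg_moment l k i = (if i = k then geg_coeff l m k * geg_moment l k k else 0)" for i
      using that assms(1) by (cases i k rule: linorder_cases) (auto simp: geg_coeff_eq_0 geg_moment_orthogonal)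
    then have "(\<Sum>i\<le>n. geg_coeff l m i * geg_moment l k i) =
        (\<Sum>i\<le>n. if i = k then geg_coeff l m k * geg_moment l k k else 0)"
      by (intro sum.cong refl)
    also have "\<dots> = geg_coeff l m k * geg_moment l k k"
      using that by simp
    finally have "(\<Sum>i\<le>n. geg_coeff l m i * geg_moment l k i) = geg_coeff l m k * geg_moment l k k" .
    then show ?thesis using that by (auto simp: geg_norm_def geg_coeff_eq_0 mult.commute)
  qed
  \<comment> \<open>Symmetry of the inner product in m and k, which reduces m > k to the case
    above.\<close>
  have "(\<Sum>i\<le>n. geg_coeff l m i * geg_moment l k i) =
      (\<Sum>i\<le>n. \<Sum>j\<le>n. geg_coeff l m i * (geg_coeff l k j * geg_weight_moment l (j + i)))"
    using assms by (simp add: geg_moment_extend[of _ n] sum_distrib_left)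
  also have "\<dots> = (\<Sum>j\<le>n. \<Sum>i\<le>n. geg_coeff l m i * (geg_coeff l k j * geg_weight_moment l (j + i)))"
    by (rule sum.swap)
  also have "\<dots> = (\<Sum>j\<le>n. geg_coeff l k j * geg_moment l m j)"
    using assms by (simp add: geg_moment_extend[of _ n] sum_distrib_left mult_ac add_ac)
  finally show ?thesis
    using *[of m k] *[of k m] assms by (cases "m \<le> k") auto
qed

text \<open>Entrywise \<beta> = C^T D^(-1) C, with D the diagonal matrix of norms. The sum starts at
  max(i, j) because coefficients above the degree vanish.\<close>

lemma beta_entry_eq:
  assumes "l > - 1 / 2" "l \<noteq> 0"
  shows "beta_entry l n i j = (\<Sum>k\<le>n. geg_coeff l k i * geg_coeff l k j / geg_norm l k)"
proof -
  note np = parameter_not_nonpos_Int[OF assms]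
  have "(\<Sum>k\<le>n. geg_coeff l k i * geg_coeff l k j / geg_norm l k) =
     (\<Sum>k=max i j..n. geg_coeff l k i * geg_coeff l k j / geg_norm l k)"
    by (rule sum.mono_neutral_right) (auto simp: geg_coeff_eq_0)
  also have "\<dots> = beta_entry l n i j"
    unfolding beta_entry_def sum_distrib_left
  proof (rule sum.cong)
    fix k assume k: "k \<in> {max i j..n}"
    have "inverse (geg_norm l k) = fact k * (l + real k) * Gamma l / (pochhammer (2 * l) k * sqrt pi * Gamma (l + 1 / 2))"
      unfolding geg_norm_eq[OF assms] by simp
    then show "geg_coeff l k i * geg_coeff l k j / geg_norm l k =
      2 ^ (i + j) * pochhammer l i * pochhammer l j * Gamma l / (fact i * fact j * sqrt pi * Gamma (l + 1 / 2)) *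
      (fact k * (l + real k) * ultraspherical (k - i) (l + real i) 0 * ultraspherical (k - j) (l + real j) 0 /
        pochhammer (2 * l) k)"
      using k by (simp add: geg_coeff_conv_ultraspherical[OF assms(1)] divide_inverse[of _ "geg_norm l k"] power_add mult_ac)
  qed simp
  finally show ?thesis by simp
qed

lemma alpha_mat_times_beta_mat:
  assumes "l > - 1 / 2" "l \<noteq> 0"
  shows "alpha_mat l n * beta_mat l n = 1\<^sub>m (n + 1)"
proof -
  \<comment> \<open>As \<alpha> is symmetric, this is \<alpha> C^T D^(-1). Orthogonality makes it a
    right inverse of C, hence also a left inverse, and X C is \<alpha> \<beta>.\<close>
  define X where "X = mat (n + 1) (n + 1) (\<lambda>(i, k). geg_moment l k i / geg_norm l k)"
  have X: "X \<in> carrier_mat (n + 1) (n + 1)" by (simp add: X_def)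
  have "geg_mat l n * X = 1\<^sub>m (n + 1)"
    unfolding geg_mat_def X_def mat_mult_mat_eq using geg_norm_nonzero[OF assms]
    by (intro eq_matI)
       (auto simp: lessThan_Suc_atMost less_Suc_eq_le geg_orthogonality[OF assms(1)] simp flip: sum_divide_distrib)
  then have *: "X * geg_mat l n = 1\<^sub>m (n + 1)"
    by (rule mat_mult_left_right_inverse[OF mat_carriers(1) X])
  have "X * geg_mat l n = alpha_mat l n * beta_mat l n"
    unfolding geg_mat_def X_def alpha_mat_def beta_mat_def mat_mult_mat_eq
  proof (intro eq_matI, goal_cases)
    case (1 i j)
    have "(\<Sum>k\<le>n. geg_moment l k i / geg_norm l k * geg_coeff l k j) =
       (\<Sum>k\<le>n. \<Sum>m\<le>n. geg_weight_moment l (i + m) * (geg_coeff l k m * geg_coeff l k j / geg_norm l k))"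
      by (intro sum.cong) (simp_all add: geg_moment_extend[of _ n] sum_distrib_left sum_distrib_right sum_divide_distrib mult_ac add_ac)
    also have "\<dots> = (\<Sum>m\<le>n. \<Sum>k\<le>n. geg_weight_moment l (i + m) * (geg_coeff l k m * geg_coeff l k j / geg_norm l k))"
      by (rule sum.swap)
    also have "\<dots> = (\<Sum>m\<le>n. alpha_entry l i m * beta_entry l n m j)"
      by (simp add: alpha_entry_eq beta_entry_eq[OF assms] sum_distrib_left)
    finally show ?case using 1 by (simp add: lessThan_Suc_atMost)
  qed simp_all
  with * show ?thesis by simp
qed

lemma inverts_alpha_beta:
  assumes "l > - 1 / 2" "l \<noteq> 0"
  shows "inverts_mat (alpha_mat l n) (beta_mat l n)" "inverts_mat (beta_mat l n) (alpha_mat l n)"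
proof -
  have "beta_mat l n * alpha_mat l n = 1\<^sub>m (n + 1)"
    by (rule mat_mult_left_right_inverse[OF mat_carriers(2,3) alpha_mat_times_beta_mat[OF assms]])
  with alpha_mat_times_beta_mat[OF assms]
  show "inverts_mat (alpha_mat l n) (beta_mat l n)" "inverts_mat (beta_mat l n) (alpha_mat l n)"
    by (simp_all add: inverts_mat_def alpha_mat_def beta_mat_def)
qed

section \<open>Continuity in the parameter and the limit at 0\<close>

lemma tendsto_det:
  fixes A :: "'b \<Rightarrow> 'a :: real_normed_field mat"
  assumes "\<And>t. A t \<in> carrier_mat n n" "L \<in> carrier_mat n n"
    and "\<And>i j. i < n \<Longrightarrow> j < n \<Longrightarrow> ((\<lambda>t. A t $$ (i, j)) \<longlongrightarrow> L $$ (i, j)) F"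
  shows "((\<lambda>t. det (A t)) \<longlongrightarrow> det L) F"
  unfolding det_def'[OF assms(1)] det_def'[OF assms(2)]
  by (intro tendsto_intros assms(3)) (auto dest: permutes_in_image)

text \<open>Entries of the adjugate are signed minors. Together with the determinant they give the
  limit of the inverse matrices.\<close>

lemma tendsto_adj_mat:
  fixes A :: "'b \<Rightarrow> 'a :: real_normed_field mat"
  assumes A: "\<And>t. A t \<in> carrier_mat n n" and L: "L \<in> carrier_mat n n"
    and lim: "\<And>i j. i < n \<Longrightarrow> j < n \<Longrightarrow> ((\<lambda>t. A t $$ (i, j)) \<longlongrightarrow> L $$ (i, j)) F"
    and ij: "i < n" "j < n"
  shows "((\<lambda>t. adj_mat (A t) $$ (i, j)) \<longlongrightarrow> adj_mat L $$ (i, j)) F"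
proof -
  have dims: "dim_row (A t) = n" "dim_col (A t) = n" "dim_row L = n" "dim_col L = n" for t
    using A[of t] L by auto
  have "((\<lambda>t. det (mat_delete (A t) j i)) \<longlongrightarrow> det (mat_delete L j i)) F"
    by (rule tendsto_det[of _ "n - 1"]) (auto simp: mat_delete_def dims intro!: lim)
  then show ?thesis
    using ij unfolding adj_mat_def cofactor_def dims by (auto intro!: tendsto_intros)
qed

lemma tendsto_alpha_entry:
  assumes "l > - 1 / 2"
  shows "((\<lambda>t. alpha_entry t i j) \<longlongrightarrow> alpha_entry l i j) (at l)"
proof -
  have pos: "x \<notin> \<int>\<^sub>\<le>\<^sub>0" if "x > 0" for x :: real
    using that by (auto elim!: nonpos_Ints_cases)
  have "(real i + real j + 1) / 2 + (l + 1 / 2) > 0"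
    using assms by (simp add: add_divide_distrib)
  then show ?thesis
    using assms unfolding alpha_entry_def Beta_def
    by (intro tendsto_intros) (auto intro!: pos simp: Gamma_eq_zero_iff)
qed

lemma det_Gamma_factor_tendsto_0:
  "\<exists>c. c \<noteq> 0 \<and> ((\<lambda>t. det_Gamma_factor t k) \<longlongrightarrow> c) (at 0)"
proof (cases k)
  case 0
  \<comment> \<open>For k = 0 the factor has the form infinity/infinity at 0. Written as the pivot,
    that is, as the total mass of the weight, it is continuous there.\<close>
  have "((\<lambda>t::real. Gamma (t + 1 / 2) * sqrt pi / Gamma (t + 1)) \<longlongrightarrow> Gamma (0 + 1 / 2) * sqrt pi / Gamma (0 + 1)) (at 0)"
    by (intro tendsto_intros) (auto simp: not_nonpos_Ints_of_gt_minus_one)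
  moreover have "eventually (\<lambda>t::real. t > - 1 / 2 \<and> t \<noteq> 0) (at 0)"
    by (intro eventually_conj eventually_neq_at_within order_tendstoD(1)[OF tendsto_ident_at]) auto
  then have "eventually (\<lambda>t::real. Gamma (t + 1 / 2) * sqrt pi / Gamma (t + 1) = det_Gamma_factor t k) (at 0)"
    by eventually_elim (auto simp: 0 geg_moment_same geg_coeff_same simp flip: pivot_eq_det_Gamma_factor)
  ultimately have "((\<lambda>t. det_Gamma_factor t k) \<longlongrightarrow> Gamma (0 + 1 / 2) * sqrt pi / Gamma (0 + 1)) (at 0)"
    by (rule Lim_transform_eventually)
  then show ?thesis by (intro exI conjI) (auto simp: Gamma_one_half_real)
next
  case (Suc m)
  \<comment> \<open>For k > 0 the arguments t + k and 2t + k stay away from the poles near t = 0, so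
    the factor is continuous as it stands.\<close>
  have k: "real k > 0" by (simp add: Suc)
  then have np: "0 + real k \<notin> \<int>\<^sub>\<le>\<^sub>0" "2 * 0 + real k \<notin> \<int>\<^sub>\<le>\<^sub>0"
    by (auto elim!: nonpos_Ints_cases)
  have "((\<lambda>t. det_Gamma_factor t k) \<longlongrightarrow> det_Gamma_factor 0 k) (at 0)"
    using k np unfolding det_Gamma_factor_def
    by (intro tendsto_intros) (auto simp: Gamma_eq_zero_iff)
  moreover have "det_Gamma_factor 0 k \<noteq> 0"
    using k np by (simp add: det_Gamma_factor_def Gamma_eq_zero_iff)
  ultimately show ?thesis by blast
qed

theorem theorem2p3:
  fixes l :: real and n :: nat
  assumes "l > - 1 / 2"
  shows "(l \<noteq> 0 \<longrightarrow>
            Determinant.det (alpha_mat l n) = det_Gamma_form l n \<and>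
            Determinant.det (alpha_mat l n) = det_Barnes_form l n \<and>
            inverts_mat (alpha_mat l n) (beta_mat l n) \<and>
            inverts_mat (beta_mat l n) (alpha_mat l n)) \<and>
         (l = 0 \<longrightarrow>
            ((\<lambda>t. det_Gamma_form t n) \<longlongrightarrow> Determinant.det (alpha_mat l n)) (at l) \<and>
            ((\<lambda>t. det_Barnes_form t n) \<longlongrightarrow> Determinant.det (alpha_mat l n)) (at l) \<and>
            (\<exists>B \<in> carrier_mat (n + 1) (n + 1).
               (\<forall>i\<le>n. \<forall>j\<le>n. ((\<lambda>t. beta_entry t n i j) \<longlongrightarrow> B $$ (i, j)) (at l)) \<and>
               inverts_mat (alpha_mat l n) B \<and> inverts_mat B (alpha_mat l n)))"
proof (intro conjI impI)
  assume "l \<noteq> 0"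
  with assms show "det (alpha_mat l n) = det_Gamma_form l n" "det (alpha_mat l n) = det_Barnes_form l n"
    "inverts_mat (alpha_mat l n) (beta_mat l n)" "inverts_mat (beta_mat l n) (alpha_mat l n)"
    by (simp_all add: det_alpha_mat det_Barnes_form_eq inverts_alpha_beta)
next
  assume l: "l = 0"
  let ?D = "det (alpha_mat l n)"
  \<comment> \<open>Near 0 but off 0 the formulas of the nonsingular case are available.\<close>
  have ev: "eventually (\<lambda>t::real. t > - 1 / 2 \<and> t \<noteq> 0) (at l)"
    unfolding l by (intro eventually_conj eventually_neq_at_within order_tendstoD(1)[OF tendsto_ident_at]) auto
  have entries: "((\<lambda>t. alpha_mat t n $$ (i, j)) \<longlongrightarrow> alpha_mat l n $$ (i, j)) (at l)"
    if "i < n + 1" "j < n + 1" for i j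
    using that tendsto_alpha_entry[OF assms] by (simp add: alpha_mat_def)
  have D: "((\<lambda>t. det (alpha_mat t n)) \<longlongrightarrow> ?D) (at l)"
    by (rule tendsto_det[OF mat_carriers(2) mat_carriers(2) entries])
  have "eventually (\<lambda>t. det (alpha_mat t n) = det_Gamma_form t n) (at l)"
    using ev by eventually_elim (simp add: det_alpha_mat)
  with D show Gamma: "((\<lambda>t. det_Gamma_form t n) \<longlongrightarrow> ?D) (at l)"
    by (rule Lim_transform_eventually)
  have "eventually (\<lambda>t. det_Gamma_form t n = det_Barnes_form t n) (at l)"
    using ev by eventually_elim (simp add: det_Barnes_form_eq)
  with Gamma show "((\<lambda>t. det_Barnes_form t n) \<longlongrightarrow> ?D) (at l)"
    by (rule Lim_transform_eventually)
  \<comment> \<open>The determinant at 0 is the limit of the product of the pivots, each of which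
    has a nonzero limit.\<close>
  have D_nz: "?D \<noteq> 0"
  proof -
    obtain c where c: "c k \<noteq> 0" "((\<lambda>t. det_Gamma_factor t k) \<longlongrightarrow> c k) (at 0)" for k
      using det_Gamma_factor_tendsto_0 by metis
    have "((\<lambda>t. det_Gamma_form t n) \<longlongrightarrow> (\<Prod>k\<le>n. c k)) (at 0)"
      unfolding det_Gamma_form_eq by (intro tendsto_prod c)
    with Gamma have "?D = (\<Prod>k\<le>n. c k)"
      unfolding l by (intro tendsto_unique[OF at_neq_bot])
    with c(1) show ?thesis by simp
  qed
  let ?A = "alpha_mat l n"
  \<comment> \<open>Cramer's form of the inverse, chosen because its entries depend continuously on
    those of \<alpha>.\<close>
  define B where "B = inverse ?D \<cdot>\<^sub>m adj_mat ?A"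
  have A: "?A \<in> carrier_mat (n + 1) (n + 1)" by (rule mat_carriers)
  note adj = adj_mat[OF A]
  have B: "B \<in> carrier_mat (n + 1) (n + 1)" using adj(1) by (simp add: B_def)
  have AB: "?A * B = 1\<^sub>m (n + 1)"
    unfolding B_def mult_smult_distrib[OF A adj(1)] adj(2) using D_nz by (intro eq_matI) auto
  then have BA: "B * ?A = 1\<^sub>m (n + 1)"
    by (rule mat_mult_left_right_inverse[OF A B])
  have "((\<lambda>t. beta_entry t n i j) \<longlongrightarrow> B $$ (i, j)) (at l)" if ij: "i \<le> n" "j \<le> n" for i j
  proof -
    have "((\<lambda>t. inverse (det (alpha_mat t n)) * adj_mat (alpha_mat t n) $$ (i, j)) \<longlongrightarrow>
        inverse ?D * adj_mat ?A $$ (i, j)) (at l)"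
      by (intro tendsto_intros D D_nz tendsto_adj_mat[OF mat_carriers(2) mat_carriers(2) entries]) (use ij in auto)
    moreover have "inverse ?D * adj_mat ?A $$ (i, j) = B $$ (i, j)"
      using ij adj(1) by (simp add: B_def)
    moreover have "eventually (\<lambda>t. det (alpha_mat t n) \<noteq> 0) (at l)"
      using D D_nz by (rule tendsto_imp_eventually_ne)
    with ev have "eventually (\<lambda>t. inverse (det (alpha_mat t n)) * adj_mat (alpha_mat t n) $$ (i, j) = beta_entry t n i j) (at l)"
    proof eventually_elim
      case (elim t)
      let ?At = "alpha_mat t n" and ?Bt = "beta_mat t n"
      have At: "?At \<in> carrier_mat (n + 1) (n + 1)" "?Bt \<in> carrier_mat (n + 1) (n + 1)" by (rule mat_carriers)+
      note adjt = adj_mat[OF At(1)]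
      \<comment> \<open>Inserting \<alpha> \<beta> = 1 and reassociating identifies \<beta> with the
        adjugate over the determinant.\<close>
      have "adj_mat ?At = adj_mat ?At * (?At * ?Bt)"
        using elim adjt(1) by (simp add: alpha_mat_times_beta_mat)
      also have "\<dots> = (adj_mat ?At * ?At) * ?Bt"
        using adjt(1) At by (simp add: assoc_mult_mat[of _ "n + 1" "n + 1" _ "n + 1" _ "n + 1"])
      also have "\<dots> = det ?At \<cdot>\<^sub>m ?Bt"
        unfolding adjt(3) mult_smult_assoc_mat[OF one_carrier_mat At(2)] using At(2) by simp
      finally have "adj_mat ?At $$ (i, j) = det ?At * beta_entry t n i j"
        using ij by (simp add: beta_mat_def)
      with elim show ?case by simp
    qed
    ultimately show ?thesis
      using Lim_transform_eventually by fastforce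
  qed
  with B AB BA show "\<exists>B \<in> carrier_mat (n + 1) (n + 1).
       (\<forall>i\<le>n. \<forall>j\<le>n. ((\<lambda>t. beta_entry t n i j) \<longlongrightarrow> B $$ (i, j)) (at l)) \<and>
       inverts_mat ?A B \<and> inverts_mat B ?A"
    by (intro bexI[of _ B]) (auto simp: inverts_mat_def alpha_mat_def)
qed

end
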